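(* Let $n$ be a positive integer whose decimal representation has an even number of digits and which is divisible by $11$. Then $f(d,m,n)$ is composite for all integers $d$ and $m$ with $0 \leq d < 10$ and $m > 0$.
   Context: For an integer $k \ge 0$ let $R(k) = \frac{10^k-1}{9}$ (the repunit, written in decimal with $k$ ones). For an integer $0 \le d < 10$, an integer $m \ge 0$ and a positive integer $n$ with exactly $t$ decimal digits, define $f(d,m,n) = dR(m)10^{t+m} + n10^m + dR(m)$; that is, for $d \neq 0$, $f(d,m,n)$ is the number whose decimal representation is obtained by writing the digit $d$ exactly $m$ times in front of $n$ and $m$ times after $n$ (e.g. $f(2,3,45) = 22245222$). For $d=0$ the formula gives $f(0,m,n)=n10^m$. *)

theory Defs
  imports "HOL-Library.Log_Nat" "HOL-Computational_Algebra.Primes"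
begin

definition composite :: "nat \<Rightarrow> bool" where
  "composite n \<longleftrightarrow> n > 1 \<and> \<not> prime n"

(* The truncating division is exact, as 9 divides 10 ^ k - 1. *)
definition repunit :: "nat \<Rightarrow> nat" where
  "repunit k = (10 ^ k - 1) div 9"

lemma nine_times_repunit: "9 * repunit k = 10 ^ k - 1"
proof -
  have "(9::nat) dvd 10 ^ k - 1"
  proof (induction k)
    case (Suc k)
    have "(10::nat) ^ Suc k - 1 = 9 * 10 ^ k + (10 ^ k - 1)"
      by simp
    with Suc show ?case
      by (metis dvd_add dvd_triv_left)
  qed simp
  then show ?thesis
    by (simp add: repunit_def)
qed

(* For n > 0, floorlog 10 n = floor (log 10 n) + 1 is the number of decimal digits of n. *)
definition decimal_length :: "nat \<Rightarrow> nat" where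
  "decimal_length n = floorlog 10 n"

lemma decimal_length_eq_iff:
  assumes "t > 0"
  shows "decimal_length n = t \<longleftrightarrow> 10 ^ (t - 1) \<le> n \<and> n < 10 ^ t"
proof -
  have le: "decimal_length n \<le> t \<longleftrightarrow> n < 10 ^ t"
    by (simp add: decimal_length_def floorlog_le_iff)
  have ge: "t \<le> decimal_length n \<longleftrightarrow> 10 ^ (t - 1) \<le> n"
    unfolding decimal_length_def
  proof
    assume "t \<le> floorlog 10 n"
    then show "10 ^ (t - 1) \<le> n"
      using \<open>t > 0\<close> by (rule floorlog_geD)
  next
    assume "10 ^ (t - 1) \<le> n"
    then show "t \<le> floorlog 10 n"
      by (rule floorlog_geI) simp
  qed
  have "decimal_length n = t \<longleftrightarrow> t \<le> decimal_length n \<and> decimal_length n \<le> t"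
    by linarith
  then show ?thesis
    unfolding le ge .
qed

(* For d = 0 the surrounding zeros in front of n do not count: wrap 0 m n = n * 10 ^ m. *)
definition wrap :: "nat \<Rightarrow> nat \<Rightarrow> nat \<Rightarrow> nat" where
  "wrap d m n =
    d * repunit m * 10 ^ (decimal_length n + m) + n * 10 ^ m + d * repunit m"

lemma wrap_example: "wrap 2 3 45 = 22245222"
proof -
  have "decimal_length 45 = 2"
    by (simp add: decimal_length_eq_iff)
  then show ?thesis
    by (simp add: wrap_def repunit_def)
qed

end

theory Submission
  imports Defs
begin

text \<open>
  Whatever \<open>d\<close> and \<open>m\<close> are, the wrapped number is divisible by \<open>11\<close>, because \<open>10\<close> is congruent
  to \<open>-1\<close> modulo \<open>11\<close>. With \<open>t\<close> the number of digits of \<open>n\<close>, the two outer blocks together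
  contribute \<open>d * R(m) * (10 ^ (t + m) + 1)\<close>. If \<open>m\<close> is even, \<open>11\<close> divides the repunit \<open>R(m)\<close>;
  if \<open>m\<close> is odd, then so is \<open>t + m\<close>, and \<open>11\<close> divides \<open>10 ^ (t + m) + 1\<close>. The inner block
  \<open>n * 10 ^ m\<close> is a multiple of \<open>11\<close> by assumption, and it alone already exceeds \<open>11\<close>, so the
  factor \<open>11\<close> is proper.
\<close>

lemma power_10_mod_11: "(10::nat) ^ k mod 11 = (if even k then 1 else 10)"
proof (induction k)
  case (Suc k)
  have "(10::nat) ^ Suc k mod 11 = 10 * (10 ^ k mod 11) mod 11"
    by (simp add: mod_mult_right_eq)
  with Suc show ?case
    by simp
qed simp

lemma eleven_dvd_repunit:
  assumes "even k"
  shows "11 dvd repunit k"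
proof -
  have "11 dvd (10::nat) ^ k - 1"
    using power_10_mod_11[of k] assms by (metis dvd_minus_mod)
  then have "11 dvd 9 * repunit k"
    by (simp add: nine_times_repunit)
  \<comment> \<open>The factor \<open>9\<close> can be cancelled because it is coprime to \<open>11\<close>.\<close>
  then show ?thesis
    by presburger
qed

lemma eleven_dvd_power_10_plus_1:
  assumes "odd k"
  shows "11 dvd (10::nat) ^ k + 1"
  using power_10_mod_11[of k] assms by presburger

text \<open>
  The evenness of \<open>t\<close> is what lets the two factors complement each other: \<open>t + m\<close> has the parity
  of \<open>m\<close>, so for each \<open>m\<close> one of the two preceding lemmas applies.
\<close>

lemma eleven_dvd_outer_blocks:
  assumes "even t"
  shows "11 dvd repunit m * (10 ^ (t + m) + 1)"
proof (cases "even m")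
  case True
  then show ?thesis
    by (intro dvd_mult2 eleven_dvd_repunit)
next
  case False
  then show ?thesis
    using assms by (intro dvd_mult eleven_dvd_power_10_plus_1) simp
qed

lemma wrap_eq_outer_plus_inner:
  "wrap d m n = d * (repunit m * (10 ^ (decimal_length n + m) + 1)) + n * 10 ^ m"
  by (simp add: wrap_def algebra_simps)

lemma less_wrap:
  assumes "n > 0" "m > 0"
  shows "n < wrap d m n"
proof -
  have "n * 1 < n * 10 ^ m"
    using assms by (intro mult_strict_left_mono one_less_power) auto
  also have "n * 10 ^ m \<le> wrap d m n"
    by (simp add: wrap_def)
  finally show ?thesis
    by simp
qed

lemma composite_if_proper_dvd:
  assumes "p dvd n" "1 < p" "p < n"
  shows "composite n"
  using assms by (auto simp: composite_def prime_nat_iff)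

theorem theorem6:
  fixes n :: nat
  assumes "n > 0"
    and "even (decimal_length n)"
    and "11 dvd n"
  shows "\<forall>d m :: nat. d < 10 \<and> m > 0 \<longrightarrow> composite (wrap d m n)"
proof (intro allI impI)
  fix d m :: nat
  assume "d < 10 \<and> m > 0"
  then have "n < wrap d m n"
    using \<open>n > 0\<close> by (simp add: less_wrap)
  moreover have "11 \<le> n"
    using \<open>11 dvd n\<close> \<open>n > 0\<close> by (rule dvd_imp_le)
  moreover have "11 dvd wrap d m n"
    unfolding wrap_eq_outer_plus_inner
    using assms by (intro dvd_add dvd_mult dvd_mult2 eleven_dvd_outer_blocks)
  ultimately show "composite (wrap d m n)"
    by (intro composite_if_proper_dvd[of 11]) auto
qed

end
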